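(* Let $\alpha\le\beta$ be real numbers, and let $u \in C([\alpha - r, \beta], \mathbb{C}^n)$ and $v \in C([\alpha, \beta + r], (\mathbb{C}^n)')$ be given. If the restrictions $u|_{[\alpha, \beta]}$ and $v|_{[\alpha, \beta]}$ are continuously differentiable, then $$\int_\alpha^\beta \left\{\left(\dot{v}(t) + \int_{-r}^0 v(t - \theta)\, d\eta(\theta)\right) u(t) + v(t) \left(\dot{u}(t) - \int_{-r}^0 d\eta(\theta)\, u(t + \theta)\right)\right\} dt = B(v^\beta, u_\beta) - B(v^\alpha, u_\alpha).$$
   Context: Let $r>0$ and let $n$ be a positive integer. $\mathbb{C}^n$ denotes column vectors, $(\mathbb{C}^n)'$ denotes $n$-dimensional complex row vectors, $M_n(\mathbb{C})$ the $n\times n$ complex matrices. Let $\eta=(\eta_{ij})\colon [-r,0]\to M_n(\mathbb{C})$ be a function of bounded variation. Integrals against $d\eta$ are Riemann–Stieltjes integrals taken componentwise: for continuous $\phi$ (column valued) and $\psi$ (row valued), $\left(\int d\eta(\theta)\,\phi(\theta)\right)_i=\sum_j\int \phi_j(\theta)\,d\eta_{ij}(\theta)$ and $\left(\int \psi(\theta)\,d\eta(\theta)\right)_j=\sum_i\int \psi_i(\theta)\,d\eta_{ij}(\theta)$. Write $C=C([-r,0],\mathbb{C}^n)$ and $C^*=C([0,r],(\mathbb{C}^n)')$ (supremum norms). The bilinear form $B\colon C^*\times C\to\mathbb{C}$ is $$B(\psi,\phi)=\psi(0)\phi(0)+\int_{-r}^0\left(\int_{-r}^{\xi}\psi(\xi-\theta)\,d\eta(\theta)\right)\phi(\xi)\,d\xi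 ,$$ where the inner integral, as a function of $\xi\in[-r,0]$, is Riemann integrable. For $t\in[\alpha,\beta]$, $u_t\in C$ and $v^t\in C^*$ are defined by $u_t(\theta)=u(t+\theta)$ for $\theta\in[-r,0]$ and $v^t(\tau)=v(t+\tau)$ for $\tau\in[0,r]$. Dots denote derivatives in $t$ of the restrictions to $[\alpha,\beta]$ (one-sided at the endpoints). *)

theory Defs
  imports "HOL-Analysis.Analysis"
begin

(* For K = {c..d}, the increment of g over K is g d - g c, that is g (Sup K) - g (Inf K). *)
definition bounded_variation_on :: "(real \<Rightarrow> 'a::real_normed_vector) \<Rightarrow> real \<Rightarrow> real \<Rightarrow> bool" where
  "bounded_variation_on g a b \<longleftrightarrow>
     (\<exists>M. \<forall>D. D division_of {a..b} \<longrightarrow> (\<Sum>K\<in>D. norm (g (Sup K) - g (Inf K))) \<le> M)"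

(* Riemann-Stieltjes integral as a limit of Riemann-Stieltjes sums when the mesh tends to 0.
   Degenerate cells {c} are allowed in a tagged division; they contribute 0. *)
definition has_rs_integral ::
    "(real \<Rightarrow> complex) \<Rightarrow> (real \<Rightarrow> complex) \<Rightarrow> real \<Rightarrow> real \<Rightarrow> complex \<Rightarrow> bool" where
  "has_rs_integral f g a b I \<longleftrightarrow>
     (\<forall>e>0. \<exists>d>0. \<forall>p. p tagged_division_of {a..b} \<and> (\<forall>(x, K)\<in>p. Sup K - Inf K < d) \<longrightarrow>
        norm ((\<Sum>(x, K)\<in>p. f x * (g (Sup K) - g (Inf K))) - I) < e)"

definition rs_integral :: "(real \<Rightarrow> complex) \<Rightarrow> (real \<Rightarrow> complex) \<Rightarrow> real \<Rightarrow> real \<Rightarrow> complex" where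
  "rs_integral f g a b = (THE I. has_rs_integral f g a b I)"

(* Row and column vectors share the type complex ^ 'n; a row times a column is scalar_product
   (bilinear, no conjugation). The entry (i, j) of eta is eta theta $ i $ j. *)
definition rs_integral_col ::
    "(real \<Rightarrow> complex ^ 'n ^ 'n) \<Rightarrow> (real \<Rightarrow> complex ^ 'n) \<Rightarrow> real \<Rightarrow> real \<Rightarrow> complex ^ 'n" where
  "rs_integral_col \<eta> \<phi> a b =
     (\<chi> i. \<Sum>j\<in>UNIV. rs_integral (\<lambda>\<theta>. \<phi> \<theta> $ j) (\<lambda>\<theta>. \<eta> \<theta> $ i $ j) a b)"

definition rs_integral_row ::
    "(real \<Rightarrow> complex ^ 'n) \<Rightarrow> (real \<Rightarrow> complex ^ 'n ^ 'n) \<Rightarrow> real \<Rightarrow> real \<Rightarrow> complex ^ 'n" where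
  "rs_integral_row \<psi> \<eta> a b =
     (\<chi> j. \<Sum>i\<in>UNIV. rs_integral (\<lambda>\<theta>. \<psi> \<theta> $ i) (\<lambda>\<theta>. \<eta> \<theta> $ i $ j) a b)"

definition bilinear_B ::
    "real \<Rightarrow> (real \<Rightarrow> complex ^ 'n ^ 'n) \<Rightarrow> (real \<Rightarrow> complex ^ 'n) \<Rightarrow> (real \<Rightarrow> complex ^ 'n) \<Rightarrow> complex" where
  "bilinear_B r \<eta> \<psi> \<phi> = scalar_product (\<psi> 0) (\<phi> 0) +
     integral {- r..0} (\<lambda>\<xi>. scalar_product (rs_integral_row (\<lambda>\<theta>. \<psi> (\<xi> - \<theta>)) \<eta> (- r) \<xi>) (\<phi> \<xi>))"

(* Both u_t (used on [-r, 0]) and v^t (used on [0, r]). *)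
definition segment_at :: "(real \<Rightarrow> 'a) \<Rightarrow> real \<Rightarrow> real \<Rightarrow> 'a" where
  "segment_at w t = (\<lambda>s. w (t + s))"

(* Differentiability of the restriction of w to S, hence one-sided at the endpoints of an
   interval; C1_differentiable_on of the library demands two-sided derivatives. *)
definition continuously_differentiable_within ::
    "(real \<Rightarrow> 'a::real_normed_vector) \<Rightarrow> real set \<Rightarrow> bool" where
  "continuously_differentiable_within w S \<longleftrightarrow>
     (\<exists>w'. (\<forall>t\<in>S. (w has_vector_derivative w' t) (at t within S)) \<and> continuous_on S w')"

end

theory Submission
  imports Defs
begin

text \<open>Write \<open>\<langle>v, u\<rangle>\<close> for the product of a row and a column. The terms with derivatives integrate to
\<open>\<langle>v \<beta>, u \<beta>\<rangle> - \<langle>v \<alpha>, u \<alpha>\<rangle>\<close> by the product rule, and these are the pointwise terms of the two values of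
\<open>B\<close>. What remains is an identity between integrals against \<open>\<eta>\<close> in which no derivative occurs. It is
linear in the entries of \<open>\<eta>\<close>, so that it suffices to treat scalar continuous functions \<open>f\<close> (an entry
of \<open>v\<close>) and \<open>g\<close> (an entry of \<open>u\<close>) and a scalar integrator (an entry of \<open>\<eta>\<close>).

Put \<open>H\<^sub>\<theta> s = f (s - \<theta>) * g s\<close>. If the order of integration may be exchanged, every integral in the
scalar identity is an integral against \<open>d\<eta>(\<theta>)\<close> of an ordinary integral of \<open>H\<^sub>\<theta>\<close>:
the advanced term gives the interval \<open>[\<alpha>, \<beta>]\<close>, the delayed term gives \<open>[\<alpha> + \<theta>, \<beta> + \<theta>]\<close> after the shift
\<open>s = t + \<theta>\<close>, and the double integral in \<open>B\<close> at time \<open>\<tau>\<close> gives \<open>[\<tau> + \<theta>, \<tau>]\<close> after the shift \<open>s = \<tau> + \<xi>\<close>.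
The claim is then the additivity of the integral over intervals (\<open>integral_shift_identity\<close>), for each
\<open>\<theta>\<close> separately: the two ways of cutting \<open>[\<alpha> + \<theta>, \<beta>]\<close> in two, at \<open>\<alpha>\<close> and at \<open>\<beta> + \<theta>\<close>, agree.

The work lies in the exchange of a Riemann integral and a Riemann-Stieltjes integral, over a rectangle
(\<open>has_rs_integral_integral\<close>) and over a triangle (\<open>has_rs_integral_integral_triangle\<close>). Both come from
\<open>integral_rs_integral_approx\<close>: Riemann-Stieltjes sums of a continuous integrand converge at a rate
that depends only on its modulus of continuity and on the variation of the integrator, hence
uniformly in a parameter, and sums may be integrated term by term. The triangle needs one more idea:
the integral against \<open>\<eta>\<close> over \<open>[a, t]\<close> is the integral over the fixed interval \<open>[a, b]\<close> against \<open>\<eta>\<close>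
stopped at \<open>t\<close>, that is \<open>\<lambda>\<theta>. \<eta> (min t \<theta>)\<close>, and all these integrators have the same variation bound.
The stopped integrator depends on \<open>t\<close> in a possibly discontinuous way, but it is still of bounded
variation in \<open>t\<close> and therefore integrable.\<close>

section \<open>Functions of bounded variation\<close>

text \<open>The function \<open>V\<close> stands for the total variation function of \<open>g\<close>. Only the inequality for increments is
ever used, so that one and the same \<open>V\<close> serves for a matrix function, for its entries, and for the
integrators derived from them; and the increments of \<open>V\<close> over the cells of a division telescope.\<close>
definition variation_bound :: "(real \<Rightarrow> real) \<Rightarrow> (real \<Rightarrow> 'a::real_normed_vector) \<Rightarrow> real \<Rightarrow> real \<Rightarrow> bool" where
  "variation_bound V g a b \<longleftrightarrow>
     (\<forall>x y. a \<le> x \<longrightarrow> x \<le> y \<longrightarrow> y \<le> b \<longrightarrow> norm (g y - g x) \<le> V y - V x)"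

lemma variation_boundD:
  "variation_bound V g a b \<Longrightarrow> a \<le> x \<Longrightarrow> x \<le> y \<Longrightarrow> y \<le> b \<Longrightarrow> norm (g y - g x) \<le> V y - V x"
  by (auto simp: variation_bound_def)

lemma variation_bound_mono:
  "variation_bound V g a b \<Longrightarrow> a \<le> x \<Longrightarrow> x \<le> y \<Longrightarrow> y \<le> b \<Longrightarrow> V x \<le> V y"
  using variation_boundD[of V g a b x y] norm_ge_zero[of "g y - g x"] by linarith

lemma division_append_interval:
  fixes a x y :: real
  assumes "D division_of {a..x}" "a \<le> x" "x \<le> y"
  shows "insert {x..y} D division_of {a..y}"
proof -
  have "{{x..y}} division_of {x..y}"
    using assms(3) by (metis box_real(2) division_of_self atLeastatMost_empty_iff2 not_less)
  moreover have "interior {a..x} \<inter> interior {x..y} = {}"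
    by auto
  ultimately have "D \<union> {{x..y}} division_of {a..x} \<union> {x..y}"
    using division_disjoint_union[OF assms(1)] by blast
  moreover have "{a..x} \<union> {x..y} = {a..y}"
    using assms by auto
  ultimately show ?thesis by simp
qed

text \<open>The total variation of \<open>g\<close> on \<open>[a, x]\<close> is such a bound: appending the interval \<open>[x, y]\<close> to a division
of \<open>[a, x]\<close> adds \<open>norm (g y - g x)\<close> to its sum.\<close>
lemma bounded_variation_imp_variation_bound:
  assumes "bounded_variation_on g a b"
  obtains V where "variation_bound V g a b"
proof -
  let ?S = "\<lambda>D. \<Sum>K\<in>D. norm (g (Sup K) - g (Inf K))"
  obtain M where M: "\<And>D. D division_of {a..b} \<Longrightarrow> ?S D \<le> M"
    using assms unfolding bounded_variation_on_def by blast
  \<comment> \<open>if \<open>{x..y}\<close> already belongs to \<open>D\<close>, it is a single point and its increment vanishes\<close>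
  have append: "?S (insert {x..y} D) = ?S D + norm (g y - g x)"
    if D: "D division_of {a..x}" and xy: "x \<le> y" for D x y
  proof (cases "{x..y} \<in> D")
    case True
    then have "{x..y} \<subseteq> {a..x}" using division_ofD(2)[OF D] by blast
    then have "y = x" using xy by auto
    then show ?thesis using True by (simp add: insert_absorb)
  next
    case False
    then show ?thesis using division_ofD(1)[OF D] xy by simp
  qed
  define V where "V x = (SUP D\<in>{D. D division_of {a..x}}. ?S D)" for x
  have bdd: "bdd_above (?S ` {D. D division_of {a..x}})" if "a \<le> x" "x \<le> b" for x
  proof (rule bdd_aboveI2)
    fix D assume "D \<in> {D. D division_of {a..x}}"
    then have D: "D division_of {a..x}" by simp
    then have "?S (insert {x..b} D) \<le> M"
      using M division_append_interval that by blast
    then show "?S D \<le> M"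
      unfolding append[OF D that(2)] by (smt (verit) norm_ge_zero)
  qed
  have "norm (g y - g x) \<le> V y - V x" if xy: "a \<le> x" "x \<le> y" "y \<le> b" for x y
  proof -
    have "V x \<le> V y - norm (g y - g x)"
      unfolding V_def[of x]
    proof (rule cSUP_least)
      have "{{a..x}} division_of {a..x}"
        using xy by (metis box_real(2) division_of_self atLeastatMost_empty_iff2 not_less)
      then show "{D. D division_of {a..x}} \<noteq> {}" by blast
    next
      fix D assume "D \<in> {D. D division_of {a..x}}"
      then have D: "D division_of {a..x}" by simp
      have "?S (insert {x..y} D) \<le> V y"
        unfolding V_def using division_append_interval[OF D xy(1,2)] bdd[of y] xy
        by (intro cSUP_upper) auto
      then show "?S D \<le> V y - norm (g y - g x)"
        unfolding append[OF D xy(2)] by simp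
    qed
    then show ?thesis by simp
  qed
  then show thesis by (intro that) (auto simp: variation_bound_def)
qed

lemma variation_bound_component:
  assumes "variation_bound V (\<eta> :: real \<Rightarrow> complex ^ 'n ^ 'm) a b"
  shows "variation_bound V (\<lambda>x. \<eta> x $ i $ j) a b"
  unfolding variation_bound_def
proof (intro allI impI)
  fix x y assume xy: "a \<le> x" "x \<le> y" "y \<le> b"
  have "norm ((\<eta> y - \<eta> x) $ i $ j) \<le> norm ((\<eta> y - \<eta> x) $ i)"
    by (rule Finite_Cartesian_Product.norm_nth_le)
  also have "\<dots> \<le> norm (\<eta> y - \<eta> x)"
    by (rule Finite_Cartesian_Product.norm_nth_le)
  also have "\<dots> \<le> V y - V x"
    using variation_boundD[OF assms xy] .
  finally show "norm (\<eta> y $ i $ j - \<eta> x $ i $ j) \<le> V y - V x"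
    by simp
qed

lemma variation_bound_stop:
  assumes "variation_bound V g a b" "y \<in> {a..b}"
  shows "variation_bound V (\<lambda>x. g (min y x)) a b"
  unfolding variation_bound_def
proof (intro allI impI)
  fix x z assume xz: "a \<le> x" "x \<le> z" "z \<le> b"
  have "norm (g (min y z) - g (min y x)) \<le> V (min y z) - V (min y x)"
    using assms(2) xz by (intro variation_boundD[OF assms(1)]) auto
  also have "\<dots> \<le> V z - V x"
  proof (cases "x \<le> y")
    case True
    then have "V (min y z) \<le> V z"
      using assms(2) xz by (intro variation_bound_mono[OF assms(1)]) auto
    with True show ?thesis by (simp add: min_absorb2)
  next
    case False
    then have "min y z = y" "min y x = y" using xz by auto
    then show ?thesis using variation_bound_mono[OF assms(1) xz] by simp
  qed
  finally show "norm (g (min y z) - g (min y x)) \<le> V z - V x" .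
qed

text \<open>Jordan decomposition: the real and the imaginary part of \<open>g\<close> become monotone when \<open>V\<close> is added.\<close>
lemma absolutely_integrable_variation_bound:
  fixes g :: "real \<Rightarrow> complex"
  assumes "variation_bound V g a b"
  shows "g absolutely_integrable_on {a..b}"
proof -
  have V: "integrable (lebesgue_on {a..b}) V"
    using variation_bound_mono[OF assms] by (intro integrable_mono_on mono_onI) auto
  have part: "integrable (lebesgue_on {a..b}) (\<lambda>x. h (g x))"
    if h: "\<And>x y. \<bar>h y - h x\<bar> \<le> norm (y - x)" for h :: "complex \<Rightarrow> real"
  proof -
    have "integrable (lebesgue_on {a..b}) (\<lambda>x. h (g x) + V x)"
    proof (intro integrable_mono_on mono_onI)
      fix x y assume "x \<in> {a..b}" "y \<in> {a..b}" "x \<le> y"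
      then show "h (g x) + V x \<le> h (g y) + V y"
        using variation_boundD[OF assms, of x y] h[of "g y" "g x"] by auto
    qed
    from Bochner_Integration.integrable_diff[OF this V] show ?thesis by simp
  qed
  have "integrable (lebesgue_on {a..b}) (\<lambda>x. complex_of_real (Re (g x)) + \<i> * complex_of_real (Im (g x)))"
    by (intro Bochner_Integration.integrable_add integrable_mult_right integrable_of_real part)
       (metis abs_Re_le_cmod minus_complex.sel(1), metis abs_Im_le_cmod minus_complex.sel(2))
  then have "integrable (lebesgue_on {a..b}) g"
    by (simp flip: complex_eq)
  then show ?thesis
    by (simp add: absolutely_integrable_on_def integrable_restrict_space set_integrable_def)
qed

lemma integrable_continuous_times_variation_bound:
  fixes g k :: "real \<Rightarrow> complex"
  assumes "variation_bound V g a b" "continuous_on {a..b} k"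
  shows "(\<lambda>t. k t * g t) integrable_on {a..b}"
proof -
  have "(\<lambda>t. k t * g t) absolutely_integrable_on {a..b}"
  proof (rule absolutely_integrable_bounded_measurable_product[OF bilinear_times])
    show "k \<in> borel_measurable (lebesgue_on {a..b})"
      using assms(2) by (intro continuous_imp_measurable_on_sets_lebesgue) auto
    show "bounded (k ` {a..b})"
      using assms(2) by (intro compact_imp_bounded compact_continuous_image) auto
  qed (use absolutely_integrable_variation_bound[OF assms(1)] in auto)
  then show ?thesis
    by (rule set_lebesgue_integral_eq_integral)
qed

section \<open>Existence of the Riemann-Stieltjes integral\<close>

definition rs_sum :: "(real \<Rightarrow> complex) \<Rightarrow> (real \<Rightarrow> complex) \<Rightarrow> (real \<times> real set) set \<Rightarrow> complex" where
  "rs_sum f g p = (\<Sum>(x, K)\<in>p. f x * (g (Sup K) - g (Inf K)))"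

definition fine_division :: "real \<Rightarrow> real \<Rightarrow> real \<Rightarrow> (real \<times> real set) set \<Rightarrow> bool" where
  "fine_division d a b p \<longleftrightarrow> p tagged_division_of {a..b} \<and> (\<forall>(x, K)\<in>p. Sup K - Inf K < d)"

lemma fine_divisionE:
  assumes "fine_division d a b p" "(x, K) \<in> p"
  obtains l m where "K = {l..m}" "a \<le> l" "l \<le> x" "x \<le> m" "m \<le> b" "m - l < d" "Sup K = m" "Inf K = l"
proof -
  have p: "p tagged_division_of {a..b}" and small: "Sup K - Inf K < d"
    using assms by (auto simp: fine_division_def)
  obtain l m where K: "K = cbox l m" using tagged_division_ofD(4)[OF p assms(2)] by blast
  moreover have "x \<in> K" "K \<subseteq> {a..b}" using tagged_division_ofD(2,3)[OF p assms(2)] .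
  ultimately show thesis using that[of l m] small by auto
qed

lemma fine_divisionD:
  assumes "fine_division d a b p" "(x, K) \<in> p"
  shows "a \<le> Inf K" "Inf K \<le> x" "x \<le> Sup K" "Sup K \<le> b" "Inf K \<le> Sup K" "Sup K - Inf K < d"
  by (rule fine_divisionE[OF assms]; simp)+

lemma has_rs_integral_iff:
  "has_rs_integral f g a b I \<longleftrightarrow>
     (\<forall>e>0. \<exists>d>0. \<forall>p. fine_division d a b p \<longrightarrow> norm (rs_sum f g p - I) < e)"
  by (simp add: has_rs_integral_def rs_sum_def fine_division_def)

lemma fine_division_exists_mesh:
  assumes "d > 0"
  obtains p where "fine_division d a b p"
proof -
  have "gauge (\<lambda>x::real. ball x (d/2))" using assms by (simp add: gauge_def)
  then obtain p where p: "p tagged_division_of {a..b}" "(\<lambda>x. ball x (d/2)) fine p"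
    using fine_division_exists_real by blast
  have "Sup K - Inf K < d" if xK: "(x, K) \<in> p" for x K
  proof -
    obtain l m where K: "K = cbox l m" using tagged_division_ofD(4)[OF p(1) xK] by blast
    have "x \<in> K" using tagged_division_ofD(2)[OF p(1) xK] .
    then have lm: "l \<le> m" "K = {l..m}" using K by auto
    then have "l \<in> ball x (d/2)" "m \<in> ball x (d/2)"
      using fineD[OF p(2) xK] by auto
    then show ?thesis using lm by (auto simp: dist_real_def abs_if split: if_splits)
  qed
  then have "fine_division d a b p" using p(1) by (auto simp: fine_division_def)
  then show thesis by (rule that)
qed

lemma fine_division_mono: "fine_division d a b p \<Longrightarrow> d \<le> d' \<Longrightarrow> fine_division d' a b p"
  by (force simp: fine_division_def)

lemma sum_increments_fine_division:
  fixes g :: "real \<Rightarrow> 'a::real_normed_vector"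
  assumes "a \<le> b" "fine_division d a b p"
  shows "(\<Sum>(x, K)\<in>p. g (Sup K) - g (Inf K)) = g b - g a"
  using assms by (simp add: additive_tagged_division_1 fine_division_def)

lemma has_rs_integral_unique:
  assumes "has_rs_integral f g a b I" "has_rs_integral f g a b J"
  shows "I = J"
proof (rule ccontr)
  assume "I \<noteq> J"
  define e where "e = norm (I - J) / 2"
  have "e > 0" using \<open>I \<noteq> J\<close> by (simp add: e_def)
  obtain d1 where "d1 > 0" and d1: "\<And>p. fine_division d1 a b p \<Longrightarrow> norm (rs_sum f g p - I) < e"
    using assms(1) \<open>e > 0\<close> unfolding has_rs_integral_iff by blast
  obtain d2 where "d2 > 0" and d2: "\<And>p. fine_division d2 a b p \<Longrightarrow> norm (rs_sum f g p - J) < e"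
    using assms(2) \<open>e > 0\<close> unfolding has_rs_integral_iff by blast
  obtain p where p: "fine_division (min d1 d2) a b p"
    using \<open>d1 > 0\<close> \<open>d2 > 0\<close> fine_division_exists_mesh[of "min d1 d2"] by auto
  have "norm (I - J) \<le> norm (rs_sum f g p - I) + norm (rs_sum f g p - J)"
    using norm_triangle_ineq4[of "rs_sum f g p - J" "rs_sum f g p - I"] by (simp add: algebra_simps)
  also have "\<dots> < e + e"
    using d1[OF fine_division_mono[OF p]] d2[OF fine_division_mono[OF p]] by (intro add_strict_mono) auto
  finally show False by (simp add: e_def)
qed

lemma rs_integral_eqI: "has_rs_integral f g a b I \<Longrightarrow> rs_integral f g a b = I"
  unfolding rs_integral_def by (blast intro: has_rs_integral_unique)

lemma has_rs_integral_cong: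
  assumes "\<And>x. x \<in> {a..b} \<Longrightarrow> f x = f' x"
  shows "has_rs_integral f g a b I \<longleftrightarrow> has_rs_integral f' g a b I"
proof -
  have "rs_sum f g p = rs_sum f' g p" if "fine_division d a b p" for d p
    unfolding rs_sum_def
    using that assms by (intro sum.cong) (auto elim!: fine_divisionE)
  then show ?thesis unfolding has_rs_integral_iff by (metis (no_types, lifting))
qed

lemma rs_integral_cong:
  assumes "\<And>x. x \<in> {a..b} \<Longrightarrow> f x = f' x"
  shows "rs_integral f g a b = rs_integral f' g a b"
  unfolding rs_integral_def
  by (intro arg_cong[where f=The] ext has_rs_integral_cong assms)

lemma has_rs_integral_mult_right:
  assumes "has_rs_integral f g a b I"
  shows "has_rs_integral (\<lambda>x. f x * c) g a b (I * c)"
  unfolding has_rs_integral_iff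
proof (intro allI impI)
  fix e :: real assume "e > 0"
  then have "e / (norm c + 1) > 0" by (simp add: add_nonneg_pos)
  then obtain d where "d > 0" and d: "\<And>p. fine_division d a b p \<Longrightarrow> norm (rs_sum f g p - I) < e / (norm c + 1)"
    using assms unfolding has_rs_integral_iff by blast
  have "norm (rs_sum (\<lambda>x. f x * c) g p - I * c) < e" if p: "fine_division d a b p" for p
  proof -
    have "rs_sum (\<lambda>x. f x * c) g p - I * c = (rs_sum f g p - I) * c"
      unfolding rs_sum_def left_diff_distrib sum_distrib_right
      by (intro arg_cong2[where f=minus] sum.cong) (auto simp: algebra_simps)
    then have "norm (rs_sum (\<lambda>x. f x * c) g p - I * c) \<le> norm (rs_sum f g p - I) * (norm c + 1)"
      by (simp add: norm_mult mult_left_mono)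
    also have "\<dots> < e"
      using d[OF p] by (simp add: pos_less_divide_eq add_nonneg_pos)
    finally show ?thesis .
  qed
  then show "\<exists>d>0. \<forall>p. fine_division d a b p \<longrightarrow> norm (rs_sum (\<lambda>x. f x * c) g p - I * c) < e"
    using \<open>d > 0\<close> by blast
qed

lemma has_rs_integral_diff:
  assumes "has_rs_integral f g a b I" "has_rs_integral f' g a b I'"
  shows "has_rs_integral (\<lambda>x. f x - f' x) g a b (I - I')"
  unfolding has_rs_integral_iff
proof (intro allI impI)
  fix e :: real assume "e > 0"
  then have "e/2 > 0" by simp
  obtain d1 where "d1 > 0" and d1: "\<And>p. fine_division d1 a b p \<Longrightarrow> norm (rs_sum f g p - I) < e/2"
    using assms(1) \<open>e/2 > 0\<close> unfolding has_rs_integral_iff by blast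
  obtain d2 where "d2 > 0" and d2: "\<And>p. fine_division d2 a b p \<Longrightarrow> norm (rs_sum f' g p - I') < e/2"
    using assms(2) \<open>e/2 > 0\<close> unfolding has_rs_integral_iff by blast
  have "norm (rs_sum (\<lambda>x. f x - f' x) g p - (I - I')) < e" if p: "fine_division (min d1 d2) a b p" for p
  proof -
    have "rs_sum (\<lambda>x. f x - f' x) g p = rs_sum f g p - rs_sum f' g p"
      unfolding rs_sum_def sum_subtractf[symmetric] by (intro sum.cong) (auto simp: algebra_simps)
    then have "norm (rs_sum (\<lambda>x. f x - f' x) g p - (I - I')) = norm ((rs_sum f g p - I) - (rs_sum f' g p - I'))"
      by (simp only: diff_diff_eq2 diff_diff_eq) (simp add: algebra_simps)
    also have "\<dots> \<le> norm (rs_sum f g p - I) + norm (rs_sum f' g p - I')"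
      by (rule norm_triangle_ineq4)
    also have "\<dots> < e"
      using d1[OF fine_division_mono[OF p]] d2[OF fine_division_mono[OF p]] by simp
    finally show ?thesis .
  qed
  then show "\<exists>d>0. \<forall>p. fine_division d a b p \<longrightarrow> norm (rs_sum (\<lambda>x. f x - f' x) g p - (I - I')) < e"
    using \<open>d1 > 0\<close> \<open>d2 > 0\<close> by (intro exI[of _ "min d1 d2"]) auto
qed

text \<open>The increment of \<open>g\<close> over \<open>K \<inter> L\<close>, or \<open>0\<close> if these intervals do not meet. It is written as the increment
over \<open>L\<close> of the single function that clamps its argument to \<open>K\<close> before it applies \<open>g\<close>; in this form
empty intersections need no separate treatment, and the sum over the cells \<open>L\<close> of a division
telescopes.\<close>
definition overlap_increment :: "(real \<Rightarrow> 'a::real_normed_vector) \<Rightarrow> real set \<Rightarrow> real set \<Rightarrow> 'a" where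
  "overlap_increment g K L =
     g (max (Inf K) (min (Sup K) (Sup L))) - g (max (Inf K) (min (Sup K) (Inf L)))"

lemma overlap_increment_commute:
  assumes "Inf K \<le> Sup K" "Inf L \<le> Sup L"
  shows "overlap_increment g K L = overlap_increment g L K"
  using assms by (auto simp: overlap_increment_def min_def max_def)

lemma sum_overlap_increment:
  fixes g :: "real \<Rightarrow> 'a::real_normed_vector"
  assumes "fine_division d a b p" "a \<le> Inf K" "Inf K \<le> Sup K" "Sup K \<le> b"
  shows "(\<Sum>(y, L)\<in>p. overlap_increment g K L) = g (Sup K) - g (Inf K)"
proof -
  have "(\<Sum>(y, L)\<in>p. overlap_increment g K L)
      = g (max (Inf K) (min (Sup K) b)) - g (max (Inf K) (min (Sup K) a))"
    using sum_increments_fine_division[OF _ assms(1), of "\<lambda>x. g (max (Inf K) (min (Sup K) x))"] assms(2-)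
    by (simp add: overlap_increment_def)
  moreover have "max (Inf K) (min (Sup K) b) = Sup K" "max (Inf K) (min (Sup K) a) = Inf K"
    using assms(2-) by auto
  ultimately show ?thesis by simp
qed

text \<open>Both sums are refined to the overlaps of the cells of \<open>p\<close> with the cells of \<open>q\<close>. The tags of two cells
that meet are less than \<open>2 * d\<close> apart, so each overlap contributes at most \<open>e\<close> times the increment of
\<open>V\<close> over it, and those increments add up to \<open>V b - V a\<close>. The bound does not depend on the integrator
except through \<open>V\<close>.\<close>
lemma rs_sum_diff_le:
  assumes V: "variation_bound V g a b" and ab: "a \<le> b"
    and p: "fine_division d a b p" and q: "fine_division d a b q"
    and osc: "\<And>x y. x \<in> {a..b} \<Longrightarrow> y \<in> {a..b} \<Longrightarrow> \<bar>x - y\<bar> < 2 * d \<Longrightarrow> norm (f x - f y) \<le> e"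
  shows "norm (rs_sum f g p - rs_sum f g q) \<le> e * (V b - V a)"
proof -
  note p' = fine_divisionD[OF p] and q' = fine_divisionD[OF q]
  have P: "rs_sum f g p = (\<Sum>(x, K)\<in>p. \<Sum>(y, L)\<in>q. f x * overlap_increment g K L)"
    unfolding rs_sum_def
  proof (intro sum.cong refl, clarify)
    fix x K assume "(x, K) \<in> p"
    then show "f x * (g (Sup K) - g (Inf K)) = (\<Sum>(y, L)\<in>q. f x * overlap_increment g K L)"
      using sum_overlap_increment[OF q, of K g] p'[of x K]
      by (simp add: case_prod_unfold flip: sum_distrib_left)
  qed
  have Q: "rs_sum f g q = (\<Sum>(x, K)\<in>p. \<Sum>(y, L)\<in>q. f y * overlap_increment g K L)"
  proof -
    have "rs_sum f g q = (\<Sum>(y, L)\<in>q. \<Sum>(x, K)\<in>p. f y * overlap_increment g K L)"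
      unfolding rs_sum_def
    proof (intro sum.cong refl, clarify)
      fix y L assume yL: "(y, L) \<in> q"
      have "(\<Sum>(x, K)\<in>p. overlap_increment g K L) = (\<Sum>(x, K)\<in>p. overlap_increment g L K)"
        by (intro sum.cong refl) (use q'(5)[OF yL] in \<open>auto intro!: overlap_increment_commute dest: p'(5)\<close>)
      then show "f y * (g (Sup L) - g (Inf L)) = (\<Sum>(x, K)\<in>p. f y * overlap_increment g K L)"
        using sum_overlap_increment[OF p, of L g] q'[OF yL]
        by (simp add: case_prod_unfold flip: sum_distrib_left)
    qed
    then show ?thesis
      unfolding case_prod_unfold by (subst sum.swap) simp
  qed
  have term_le: "norm (f x * overlap_increment g K L - f y * overlap_increment g K L) \<le> e * overlap_increment V K L"
    if xK: "(x, K) \<in> p" and yL: "(y, L) \<in> q" for x y K L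
  proof (cases "overlap_increment V K L = 0")
    case False
    \<comment> \<open>if the cells did not meet, clamping would send both ends of one of them to the same point\<close>
    have "Inf K \<le> Sup L"
    proof (rule ccontr)
      assume "\<not> Inf K \<le> Sup L"
      then have "max (Inf K) (min (Sup K) (Sup L)) = Inf K" "max (Inf K) (min (Sup K) (Inf L)) = Inf K"
        using p'(5)[OF xK] q'(5)[OF yL] by auto
      with False show False by (simp add: overlap_increment_def)
    qed
    moreover have "Inf L \<le> Sup K"
    proof (rule ccontr)
      assume "\<not> Inf L \<le> Sup K"
      then have "max (Inf K) (min (Sup K) (Sup L)) = Sup K" "max (Inf K) (min (Sup K) (Inf L)) = Sup K"
        using p'(5)[OF xK] q'(5)[OF yL] by auto
      with False show False by (simp add: overlap_increment_def)
    qed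
    ultimately have "\<bar>x - y\<bar> < 2 * d"
      using p'[OF xK] q'[OF yL] unfolding abs_less_iff by linarith
    then have "norm (f x - f y) \<le> e" using osc p'[OF xK] q'[OF yL] by auto
    moreover have "norm (overlap_increment g K L) \<le> overlap_increment V K L"
      unfolding overlap_increment_def
      using p'[OF xK] q'[OF yL] by (intro variation_boundD[OF V]) auto
    ultimately show ?thesis
      by (simp add: norm_mult mult_mono' flip: left_diff_distrib)
  next
    case True
    have "norm (overlap_increment g K L) \<le> overlap_increment V K L"
      unfolding overlap_increment_def
      using p'[OF xK] q'[OF yL] by (intro variation_boundD[OF V]) auto
    then show ?thesis using True by simp
  qed
  have "norm (rs_sum f g p - rs_sum f g q)
      = norm (\<Sum>z\<in>p. \<Sum>w\<in>q. f (fst z) * overlap_increment g (snd z) (snd w) - f (fst w) * overlap_increment g (snd z) (snd w))"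
    unfolding P Q by (simp add: case_prod_unfold sum_subtractf)
  also have "\<dots> \<le> (\<Sum>z\<in>p. \<Sum>w\<in>q. e * overlap_increment V (snd z) (snd w))"
    using term_le by (intro sum_norm_le) auto
  also have "\<dots> = e * (\<Sum>(x, K)\<in>p. \<Sum>(y, L)\<in>q. overlap_increment V K L)"
    by (simp add: case_prod_unfold sum_distrib_left)
  also have "(\<Sum>(x, K)\<in>p. \<Sum>(y, L)\<in>q. overlap_increment V K L) = (\<Sum>(x, K)\<in>p. V (Sup K) - V (Inf K))"
    by (intro sum.cong refl) (auto intro!: sum_overlap_increment[OF q] dest: p')
  also have "\<dots> = V b - V a"
    by (rule sum_increments_fine_division[OF ab p])
  finally show ?thesis .
qed

text \<open>The error of a Riemann-Stieltjes sum, with constants that are explicit enough to be uniform in a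
parameter: this is the previous bound in the limit of ever finer \<open>q\<close>.\<close>
lemma rs_sum_has_rs_integral_le:
  assumes V: "variation_bound V g a b" and ab: "a \<le> b" and I: "has_rs_integral f g a b I"
    and d: "d > 0" and p: "fine_division d a b p"
    and osc: "\<And>x y. x \<in> {a..b} \<Longrightarrow> y \<in> {a..b} \<Longrightarrow> \<bar>x - y\<bar> < 2 * d \<Longrightarrow> norm (f x - f y) \<le> e"
  shows "norm (rs_sum f g p - I) \<le> e * (V b - V a)"
proof (rule field_le_epsilon)
  fix h :: real assume "h > 0"
  then obtain d' where "d' > 0" and d': "\<And>q. fine_division d' a b q \<Longrightarrow> norm (rs_sum f g q - I) < h"
    using I unfolding has_rs_integral_iff by blast
  obtain q where q: "fine_division (min d d') a b q"
    using d \<open>d' > 0\<close> fine_division_exists_mesh[of "min d d'"] by auto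
  have "norm (rs_sum f g p - I) \<le> norm (rs_sum f g p - rs_sum f g q) + norm (rs_sum f g q - I)"
    using norm_triangle_ineq[of "rs_sum f g p - rs_sum f g q" "rs_sum f g q - I"] by simp
  also have "\<dots> \<le> e * (V b - V a) + h"
    using rs_sum_diff_le[OF V ab p fine_division_mono[OF q] osc] d'[OF fine_division_mono[OF q]]
    by (intro add_mono) auto
  finally show "norm (rs_sum f g p - I) \<le> e * (V b - V a) + h" .
qed

text \<open>By uniform continuity of \<open>f\<close>, the sums over all sufficiently fine divisions are close to each other; the
integral is the limit along any sequence of divisions whose mesh tends to \<open>0\<close>.\<close>
lemma has_rs_integral_rs_integral:
  assumes V: "variation_bound V g a b" and ab: "a \<le> b" and f: "continuous_on {a..b} f"
  shows "has_rs_integral f g a b (rs_integral f g a b)"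
proof -
  define W where "W = V b - V a + 1"
  have W: "W > 0"
    using variation_bound_mono[OF V, of a b] ab by (simp add: W_def)
  have modulus: "\<exists>d>0. \<forall>p q. fine_division d a b p \<longrightarrow> fine_division d a b q \<longrightarrow>
                   norm (rs_sum f g p - rs_sum f g q) < e" if "e > 0" for e
  proof -
    have "uniformly_continuous_on {a..b} f"
      using f by (simp add: compact_uniformly_continuous)
    moreover have "e / W > 0" using that W by simp
    ultimately obtain d where "d > 0"
      and d: "\<And>x y. x \<in> {a..b} \<Longrightarrow> y \<in> {a..b} \<Longrightarrow> dist y x < d \<Longrightarrow> dist (f y) (f x) < e / W"
      unfolding uniformly_continuous_on_def by blast
    have "norm (rs_sum f g p - rs_sum f g q) < e"
      if p: "fine_division (d/2) a b p" and q: "fine_division (d/2) a b q" for p q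
    proof -
      have "norm (rs_sum f g p - rs_sum f g q) \<le> e / W * (V b - V a)"
      proof (rule rs_sum_diff_le[OF V ab p q])
        fix x y assume "x \<in> {a..b}" "y \<in> {a..b}" "\<bar>x - y\<bar> < 2 * (d/2)"
        then show "norm (f x - f y) \<le> e / W"
          using d[of y x] by (simp add: dist_norm less_imp_le)
      qed
      also have "\<dots> < e / W * W"
        using \<open>e / W > 0\<close> by (intro mult_strict_left_mono) (auto simp: W_def)
      also have "\<dots> = e" using W by simp
      finally show ?thesis .
    qed
    then show ?thesis using \<open>d > 0\<close> by (intro exI[of _ "d/2"]) auto
  qed
  have "\<exists>p. fine_division (inverse (real (Suc n))) a b p" for n
    using fine_division_exists_mesh[of "inverse (real (Suc n))"] by (metis inverse_positive_iff_positive of_nat_0_less_iff zero_less_Suc)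
  then obtain p where p: "\<And>n. fine_division (inverse (real (Suc n))) a b (p n)"
    by metis
  have eventually_fine: "\<forall>\<^sub>F n in sequentially. fine_division d a b (p n)" if "d > 0" for d
  proof -
    have "\<forall>\<^sub>F n in sequentially. inverse (real (Suc n)) < d"
      using LIMSEQ_inverse_real_of_nat that by (rule order_tendstoD(2))
    then show ?thesis
      by (rule eventually_mono) (use p fine_division_mono less_imp_le in blast)
  qed
  have "Cauchy (\<lambda>n. rs_sum f g (p n))"
  proof (rule metric_CauchyI)
    fix e :: real assume "e > 0"
    then obtain d where "d > 0" and d: "\<And>p q. fine_division d a b p \<Longrightarrow> fine_division d a b q \<Longrightarrow>
                   norm (rs_sum f g p - rs_sum f g q) < e"
      using modulus by blast
    obtain N where "\<And>n. n \<ge> N \<Longrightarrow> fine_division d a b (p n)"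
      using eventually_fine[OF \<open>d > 0\<close>] unfolding eventually_sequentially by blast
    then show "\<exists>M. \<forall>m\<ge>M. \<forall>n\<ge>M. dist (rs_sum f g (p m)) (rs_sum f g (p n)) < e"
      using d unfolding dist_norm by blast
  qed
  then obtain I where I: "(\<lambda>n. rs_sum f g (p n)) \<longlonglongrightarrow> I"
    using Cauchy_convergent convergent_def by blast
  have "has_rs_integral f g a b I"
    unfolding has_rs_integral_iff
  proof (intro allI impI)
    fix e :: real assume "e > 0"
    then obtain d where "d > 0" and d: "\<And>p q. fine_division d a b p \<Longrightarrow> fine_division d a b q \<Longrightarrow>
                   norm (rs_sum f g p - rs_sum f g q) < e/2"
      using modulus[of "e/2"] by auto
    have "norm (rs_sum f g q - I) < e" if q: "fine_division d a b q" for q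
    proof -
      have "(\<lambda>n. norm (rs_sum f g q - rs_sum f g (p n))) \<longlonglongrightarrow> norm (rs_sum f g q - I)"
        by (intro tendsto_intros I)
      moreover have "\<forall>\<^sub>F n in sequentially. norm (rs_sum f g q - rs_sum f g (p n)) \<le> e/2"
        using eventually_fine[OF \<open>d > 0\<close>] by (rule eventually_mono) (rule less_imp_le[OF d[OF q]])
      ultimately have "norm (rs_sum f g q - I) \<le> e/2"
        by (rule tendsto_upperbound) simp
      then show ?thesis using \<open>e > 0\<close> by simp
    qed
    then show "\<exists>d>0. \<forall>p. fine_division d a b p \<longrightarrow> norm (rs_sum f g p - I) < e"
      using \<open>d > 0\<close> by blast
  qed
  then show ?thesis using rs_integral_eqI by blast
qed

text \<open>A fine division of \<open>[a, t]\<close> extends to one of \<open>[a, b]\<close>, and the stopped integrator has no increment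
over the cells that were added.\<close>
lemma has_rs_integral_stop_imp_restrict:
  assumes I: "has_rs_integral f (\<lambda>x. g (min t x)) a b I" and t: "a \<le> t" "t \<le> b"
  shows "has_rs_integral f g a t I"
  unfolding has_rs_integral_iff
proof (intro allI impI)
  fix e :: real assume "e > 0"
  then obtain d where "d > 0"
    and d: "\<And>p. fine_division d a b p \<Longrightarrow> norm (rs_sum f (\<lambda>x. g (min t x)) p - I) < e"
    using I unfolding has_rs_integral_iff by blast
  have "norm (rs_sum f g p - I) < e" if p: "fine_division d a t p" for p
  proof -
    let ?s = "\<lambda>(x, K). f x * (g (min t (Sup K)) - g (min t (Inf K)))"
    obtain q where q: "fine_division d t b q"
      using \<open>d > 0\<close> fine_division_exists_mesh by blast
    have "p \<union> q tagged_division_of {a..t} \<union> {t..b}"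
      using p q by (intro tagged_division_Un) (auto simp: fine_division_def)
    moreover have "{a..t} \<union> {t..b} = {a..b}" using t by auto
    ultimately have pq: "fine_division d a b (p \<union> q)"
      using p q by (auto simp: fine_division_def)
    have fin: "finite p" "finite q"
      using p q by (auto simp: fine_division_def)
    have zero: "?s z = 0" if "z \<in> q" for z
      using that fine_divisionD[OF q, of "fst z" "snd z"] by (cases z) (auto simp: min_absorb1)
    have "sum ?s (p \<union> q) = sum ?s p"
      using fin zero by (intro sum.mono_neutral_right) auto
    also have "\<dots> = rs_sum f g p"
      unfolding rs_sum_def
      using fine_divisionD(4,5)[OF p] by (intro sum.cong refl) (force simp: min_absorb2)
    finally show ?thesis
      using d[OF pq] by (simp add: rs_sum_def)
  qed
  then show "\<exists>d>0. \<forall>p. fine_division d a t p \<longrightarrow> norm (rs_sum f g p - I) < e"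
    using \<open>d > 0\<close> by blast
qed

lemma rs_integral_eq_stop:
  assumes V: "variation_bound V g a b" and t: "t \<in> {a..b}" and f: "continuous_on {a..b} f"
  shows "rs_integral f g a t = rs_integral f (\<lambda>x. g (min t x)) a b"
proof -
  have "has_rs_integral f (\<lambda>x. g (min t x)) a b (rs_integral f (\<lambda>x. g (min t x)) a b)"
    using t by (intro has_rs_integral_rs_integral[OF variation_bound_stop[OF V t] _ f]) auto
  from has_rs_integral_stop_imp_restrict[OF this] show ?thesis
    using t by (auto intro: rs_integral_eqI)
qed

section \<open>Exchanging the order of integration\<close>

lemma norm_integral_le_on_subinterval:
  fixes E :: "real \<Rightarrow> complex"
  assumes E: "E integrable_on {a..b}" and sub: "a \<le> l" "l \<le> m" "m \<le> b"
    and off: "\<And>t. t \<in> {a..b} \<Longrightarrow> t \<notin> {l..m} \<Longrightarrow> E t = 0"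
    and bound: "\<And>t. t \<in> {l..m} \<Longrightarrow> norm (E t) \<le> C"
  shows "norm (integral {a..b} E) \<le> C * (m - l)"
proof -
  have "C \<ge> 0" using order_trans[OF norm_ge_zero bound[of l]] sub by simp
  have *: "((\<lambda>t. if t \<in> {l..m} then C else 0) has_integral C * (m - l)) {a..b}"
    using has_integral_const_real[of C l m] sub
    by (subst has_integral_restrict) (auto simp: mult.commute)
  have "norm (integral {a..b} E) \<le> integral {a..b} (\<lambda>t. if t \<in> {l..m} then C else 0)"
    using E off bound * by (intro integral_norm_bound_integral) auto
  then show ?thesis using integral_unique[OF *] by simp
qed

text \<open>Termwise integration of Riemann-Stieltjes sums, for an integrator \<open>G t\<close> that may depend on the
parameter. The integrators share one variation bound and \<open>h\<close> is uniformly continuous, so the sums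
converge uniformly in \<open>t\<close>. This makes the limit integrable and carries the convergence over to the
integrals. Integrability of the products with \<open>G t y\<close> is a hypothesis because \<open>G t y\<close> need not be
continuous in \<open>t\<close>.\<close>
lemma integral_rs_integral_approx:
  fixes h :: "real \<Rightarrow> real \<Rightarrow> complex" and G :: "real \<Rightarrow> real \<Rightarrow> complex"
  assumes ab: "a \<le> b" and cd: "c \<le> d"
    and V: "\<And>t. t \<in> {c..d} \<Longrightarrow> variation_bound V (G t) a b"
    and int: "\<And>x y. x \<in> {a..b} \<Longrightarrow> y \<in> {a..b} \<Longrightarrow> (\<lambda>t. h t x * G t y) integrable_on {c..d}"
    and h: "continuous_on ({c..d} \<times> {a..b}) (\<lambda>(t, x). h t x)"
  shows "(\<lambda>t. rs_integral (h t) (G t) a b) integrable_on {c..d}"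
    and "\<And>e. e > 0 \<Longrightarrow> \<exists>\<delta>>0. \<forall>p. fine_division \<delta> a b p \<longrightarrow>
       norm ((\<Sum>(x, K)\<in>p. integral {c..d} (\<lambda>t. h t x * (G t (Sup K) - G t (Inf K)))) -
             integral {c..d} (\<lambda>t. rs_integral (h t) (G t) a b)) < e"
proof -
  let ?R = "\<lambda>t. rs_integral (h t) (G t) a b"
  define W where "W = V b - V a + 1"
  have W: "W > 0"
    using variation_bound_mono[OF V, of c a b] ab cd by (simp add: W_def)
  have has: "has_rs_integral (h t) (G t) a b (?R t)" if t: "t \<in> {c..d}" for t
  proof (rule has_rs_integral_rs_integral[OF V[OF t] ab])
    have "continuous_on {a..b} ((\<lambda>(t, x). h t x) \<circ> Pair t)"
      using t by (intro continuous_on_compose continuous_intros continuous_on_subset[OF h]) auto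
    then show "continuous_on {a..b} (h t)" by (simp add: o_def)
  qed
  have unif: "\<exists>\<delta>>0. \<forall>p. fine_division \<delta> a b p \<longrightarrow>
      (\<forall>t\<in>{c..d}. norm (?R t - rs_sum (h t) (G t) p) \<le> e)" if "e > 0" for e
  proof -
    have "uniformly_continuous_on ({c..d} \<times> {a..b}) (\<lambda>(t, x). h t x)"
      using h by (simp add: compact_uniformly_continuous compact_Times)
    moreover have "e / W > 0" using that W by simp
    ultimately obtain \<delta> where "\<delta> > 0"
      and \<delta>: "\<And>z w. z \<in> {c..d} \<times> {a..b} \<Longrightarrow> w \<in> {c..d} \<times> {a..b} \<Longrightarrow> dist w z < \<delta> \<Longrightarrow>
             dist (case w of (t, x) \<Rightarrow> h t x) (case z of (t, x) \<Rightarrow> h t x) < e / W"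
      unfolding uniformly_continuous_on_def by blast
    have "norm (?R t - rs_sum (h t) (G t) p) \<le> e" if p: "fine_division (\<delta>/2) a b p" and t: "t \<in> {c..d}" for p t
    proof -
      have "norm (rs_sum (h t) (G t) p - ?R t) \<le> e / W * (V b - V a)"
      proof (rule rs_sum_has_rs_integral_le[OF V[OF t] ab has[OF t] _ p])
        fix x y assume "x \<in> {a..b}" "y \<in> {a..b}" "\<bar>x - y\<bar> < 2 * (\<delta>/2)"
        then show "norm (h t x - h t y) \<le> e / W"
          using \<delta>[of "(t, y)" "(t, x)"] t by (simp add: dist_norm dist_Pair_Pair less_imp_le)
      qed (use \<open>\<delta> > 0\<close> in auto)
      also have "\<dots> \<le> e / W * W"
        using \<open>e / W > 0\<close> by (intro mult_left_mono) (auto simp: W_def)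
      also have "\<dots> = e" using W by simp
      finally show ?thesis by (simp add: norm_minus_commute)
    qed
    then show ?thesis using \<open>\<delta> > 0\<close> by (intro exI[of _ "\<delta>/2"]) auto
  qed
  have term_int: "(\<lambda>t. h t x * (G t (Sup K) - G t (Inf K))) integrable_on {c..d}"
    if p: "fine_division \<delta> a b p" and xK: "(x, K) \<in> p" for x K p \<delta>
    unfolding right_diff_distrib
    using fine_divisionD[OF p xK] by (intro integrable_diff int) auto
  have sum_int: "rs_sum (h t) (G t) p = (\<Sum>z\<in>p. h t (fst z) * (G t (Sup (snd z)) - G t (Inf (snd z))))" for t p
    by (simp add: rs_sum_def case_prod_unfold)
  have sum_integrable: "(\<lambda>t. rs_sum (h t) (G t) p) integrable_on {c..d}" if p: "fine_division \<delta> a b p" for p \<delta>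
    unfolding sum_int using p
    by (intro integrable_sum term_int[OF p]) (auto simp: fine_division_def)
  show integrable: "?R integrable_on {c..d}"
    unfolding box_real(2)[symmetric]
  proof (rule integrable_uniform_limit)
    fix e :: real assume "e > 0"
    then obtain \<delta> where "\<delta> > 0" and \<delta>: "\<And>p. fine_division \<delta> a b p \<Longrightarrow>
        (\<forall>t\<in>{c..d}. norm (?R t - rs_sum (h t) (G t) p) \<le> e)"
      using unif by blast
    obtain p where p: "fine_division \<delta> a b p"
      using \<open>\<delta> > 0\<close> fine_division_exists_mesh by blast
    show "\<exists>S. (\<forall>t\<in>cbox c d. norm (?R t - S t) \<le> e) \<and> S integrable_on cbox c d"
      using \<delta>[OF p] sum_integrable[OF p] by auto
  qed
  fix e :: real assume "e > 0"
  define e' where "e' = e / (2 * (d - c + 1))"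
  have "e' > 0" using \<open>e > 0\<close> cd by (simp add: e'_def)
  then obtain \<delta> where "\<delta> > 0" and \<delta>: "\<And>p. fine_division \<delta> a b p \<Longrightarrow>
        (\<forall>t\<in>{c..d}. norm (?R t - rs_sum (h t) (G t) p) \<le> e')"
    using unif by blast
  have "norm ((\<Sum>(x, K)\<in>p. integral {c..d} (\<lambda>t. h t x * (G t (Sup K) - G t (Inf K)))) - integral {c..d} ?R) < e"
    if p: "fine_division \<delta> a b p" for p
  proof -
    have "(\<Sum>(x, K)\<in>p. integral {c..d} (\<lambda>t. h t x * (G t (Sup K) - G t (Inf K))))
        = integral {c..d} (\<lambda>t. rs_sum (h t) (G t) p)"
      unfolding sum_int case_prod_unfold using p
      by (intro integral_sum[symmetric] term_int[OF p]) (auto simp: fine_division_def)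
    then have "norm ((\<Sum>(x, K)\<in>p. integral {c..d} (\<lambda>t. h t x * (G t (Sup K) - G t (Inf K)))) - integral {c..d} ?R)
        = norm (integral {c..d} (\<lambda>t. ?R t - rs_sum (h t) (G t) p))"
      using integrable sum_integrable[OF p] by (simp add: integral_diff norm_minus_commute)
    also have "\<dots> \<le> e' * (d - c)"
      using cd \<delta>[OF p] integrable sum_integrable[OF p]
      by (intro norm_integral_le_on_subinterval integrable_diff) auto
    also have "\<dots> < e"
    proof -
      have "e' * (d - c) < e' * (2 * (d - c + 1))"
        using \<open>e' > 0\<close> cd by (intro mult_strict_left_mono) auto
      then show ?thesis using cd by (simp add: e'_def)
    qed
    finally show ?thesis .
  qed
  then show "\<exists>\<delta>>0. \<forall>p. fine_division \<delta> a b p \<longrightarrow>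
       norm ((\<Sum>(x, K)\<in>p. integral {c..d} (\<lambda>t. h t x * (G t (Sup K) - G t (Inf K)))) -
             integral {c..d} ?R) < e"
    using \<open>\<delta> > 0\<close> by blast
qed

text \<open>Fubini's theorem on a rectangle. With a fixed integrator the integrated sums are exactly the
Riemann-Stieltjes sums of \<open>\<lambda>x. integral {c..d} (\<lambda>t. h t x)\<close>, and their convergence also shows that the
integral of this function exists.\<close>
lemma
  fixes g :: "real \<Rightarrow> complex" and h :: "real \<Rightarrow> real \<Rightarrow> complex"
  assumes V: "variation_bound V g a b" and ab: "a \<le> b" and cd: "c \<le> d"
    and h: "continuous_on ({c..d} \<times> {a..b}) (\<lambda>(t, x). h t x)"
  shows integrable_rs_integral: "(\<lambda>t. rs_integral (h t) g a b) integrable_on {c..d}"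
    and has_rs_integral_integral:
      "has_rs_integral (\<lambda>x. integral {c..d} (\<lambda>t. h t x)) g a b
         (integral {c..d} (\<lambda>t. rs_integral (h t) g a b))"
proof -
  have int: "(\<lambda>t. h t x * g y) integrable_on {c..d}" if "x \<in> {a..b}" for x y
  proof -
    have "continuous_on {c..d} ((\<lambda>(t, x). h t x) \<circ> (\<lambda>t. (t, x)))"
      using that by (intro continuous_on_compose continuous_intros continuous_on_subset[OF h]) auto
    then have "continuous_on {c..d} (\<lambda>t. h t x * g y)"
      by (intro continuous_intros) (simp add: o_def)
    then show ?thesis by (rule integrable_continuous_real)
  qed
  note approx = integral_rs_integral_approx[of a b c d V "\<lambda>_. g" h, OF ab cd V int h]
  show "(\<lambda>t. rs_integral (h t) g a b) integrable_on {c..d}"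
    by (rule approx(1)) auto
  have "(\<Sum>(x, K)\<in>p. integral {c..d} (\<lambda>t. h t x * (g (Sup K) - g (Inf K))))
      = rs_sum (\<lambda>x. integral {c..d} (\<lambda>t. h t x)) g p" for p
    by (simp add: rs_sum_def)
  with approx(2) show "has_rs_integral (\<lambda>x. integral {c..d} (\<lambda>t. h t x)) g a b
         (integral {c..d} (\<lambda>t. rs_integral (h t) g a b))"
    unfolding has_rs_integral_iff by simp
qed

text \<open>Fubini's theorem on the triangle \<open>a \<le> x \<le> t \<le> b\<close>. The inner integrals are rewritten as integrals over
\<open>[a, b]\<close> against the integrator stopped at \<open>t\<close>. For a cell \<open>[l, m]\<close> the stopped increment is \<open>0\<close> when
\<open>t \<le> l\<close> and the full increment when \<open>m \<le> t\<close>. Thus it differs from the increment cut off at the tag only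
for \<open>t\<close> in the cell itself. Up to a bound for \<open>h\<close>, this costs at most the length of the cell times the
variation in it, and the total is of the order of the mesh.\<close>
lemma
  fixes g :: "real \<Rightarrow> complex" and h :: "real \<Rightarrow> real \<Rightarrow> complex"
  assumes V: "variation_bound V g a b" and ab: "a \<le> b"
    and h: "continuous_on ({a..b} \<times> {a..b}) (\<lambda>(t, x). h t x)"
  shows integrable_rs_integral_triangle: "(\<lambda>t. rs_integral (h t) g a t) integrable_on {a..b}"
    and has_rs_integral_integral_triangle:
      "has_rs_integral (\<lambda>x. integral {x..b} (\<lambda>t. h t x)) g a b
         (integral {a..b} (\<lambda>t. rs_integral (h t) g a t))"
proof -
  let ?R = "\<lambda>t. rs_integral (h t) g a t"
  have h1: "continuous_on {a..b} (h t)" if "t \<in> {a..b}" for t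
  proof -
    have "continuous_on {a..b} ((\<lambda>(t, x). h t x) \<circ> Pair t)"
      using that by (intro continuous_on_compose continuous_intros continuous_on_subset[OF h]) auto
    then show ?thesis by (simp add: o_def)
  qed
  have h2: "continuous_on {a..b} (\<lambda>t. h t x)" if "x \<in> {a..b}" for x
  proof -
    have "continuous_on {a..b} ((\<lambda>(t, x). h t x) \<circ> (\<lambda>t. (t, x)))"
      using that by (intro continuous_on_compose continuous_intros continuous_on_subset[OF h]) auto
    then show ?thesis by (simp add: o_def)
  qed
  have stop: "?R t = rs_integral (h t) (\<lambda>x. g (min t x)) a b" if "t \<in> {a..b}" for t
    using rs_integral_eq_stop[OF V that h1[OF that]] .
  have int: "(\<lambda>t. h t x * g (min t y)) integrable_on {a..b}" if "x \<in> {a..b}" "y \<in> {a..b}" for x y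
    using integrable_continuous_times_variation_bound[OF variation_bound_stop[OF V that(2)] h2[OF that(1)]]
    by (simp add: min.commute)
  note approx = integral_rs_integral_approx[of a b a b V "\<lambda>t x. g (min t x)" h,
      OF ab ab variation_bound_stop[OF V] int h]
  have "(\<lambda>t. rs_integral (h t) (\<lambda>x. g (min t x)) a b) integrable_on {a..b}"
    by (rule approx(1)) auto
  then show "?R integrable_on {a..b}"
    by (rule integrable_eq) (simp add: stop)
  have R: "integral {a..b} (\<lambda>t. rs_integral (h t) (\<lambda>x. g (min t x)) a b) = integral {a..b} ?R"
    by (intro integral_cong) (simp add: stop)
  obtain M where "M > 0" and M: "\<And>t x. t \<in> {a..b} \<Longrightarrow> x \<in> {a..b} \<Longrightarrow> norm (h t x) \<le> M"
  proof -
    have "bounded ((\<lambda>(t, x). h t x) ` ({a..b} \<times> {a..b}))"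
      using h by (intro compact_imp_bounded compact_continuous_image compact_Times) auto
    then show thesis using that unfolding bounded_pos by (force simp: image_iff)
  qed
  define W where "W = V b - V a + 1"
  have W: "W > 0"
    using variation_bound_mono[OF V, of a b] ab by (simp add: W_def)
  have cell: "norm (integral {x..b} (\<lambda>t. h t x) * (g (Sup K) - g (Inf K))
                - integral {a..b} (\<lambda>t. h t x * (g (min t (Sup K)) - g (min t (Inf K)))))
              \<le> M * \<delta> * (V (Sup K) - V (Inf K))"
    if p: "fine_division \<delta> a b p" and xK: "(x, K) \<in> p" for x K p \<delta>
  proof -
    obtain l m where lm: "a \<le> l" "l \<le> x" "x \<le> m" "m \<le> b" "m - l < \<delta>" "Sup K = m" "Inf K = l"
      using fine_divisionE[OF p xK] by metis
    \<comment> \<open>\<open>?E1\<close> belongs to the sum for the exchanged integral, \<open>?E2\<close> to the sum for the stopped integrators\<close>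
    let ?E1 = "\<lambda>t. (if t \<in> {x..b} then h t x else 0) * (g m - g l)"
    let ?E2 = "\<lambda>t. h t x * (g (min t m) - g (min t l))"
    have x: "x \<in> {a..b}" using lm by auto
    have "((\<lambda>t. h t x) has_integral integral {x..b} (\<lambda>t. h t x)) {x..b}"
      using x by (intro integrable_integral integrable_continuous_real continuous_on_subset[OF h2[OF x]]) auto
    then have "((\<lambda>t. if t \<in> {x..b} then h t x else 0) has_integral integral {x..b} (\<lambda>t. h t x)) {a..b}"
      using x by (subst has_integral_restrict) auto
    then have E1: "(?E1 has_integral integral {x..b} (\<lambda>t. h t x) * (g m - g l)) {a..b}"
      by (rule has_integral_mult_left)
    have E2: "?E2 integrable_on {a..b}"
      unfolding right_diff_distrib using lm by (intro integrable_diff int) auto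
    have "norm (integral {a..b} (\<lambda>t. ?E1 t - ?E2 t)) \<le> M * (V m - V l) * (m - l)"
    proof (rule norm_integral_le_on_subinterval)
      show "(\<lambda>t. ?E1 t - ?E2 t) integrable_on {a..b}"
        using E1 E2 by (intro integrable_diff) (auto simp: integrable_on_def)
      fix t assume t: "t \<in> {l..m}"
      then have ht: "norm (h t x) \<le> M" using M lm by auto
      show "norm (?E1 t - ?E2 t) \<le> M * (V m - V l)"
      proof (cases "t < x")
        case True
        then have "?E1 t - ?E2 t = - (h t x * (g t - g l))"
          using t by (simp add: min_absorb1 min_absorb2)
        moreover have "norm (g t - g l) \<le> V m - V l"
          using variation_boundD[OF V, of l t] variation_bound_mono[OF V, of t m] t lm by force
        ultimately show ?thesis
          using ht by (simp add: norm_mult mult_mono')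
      next
        case False
        then have "?E1 t - ?E2 t = h t x * (g m - g t)"
          using t lm by (simp add: min_absorb1 min_absorb2 algebra_simps)
        moreover have "norm (g m - g t) \<le> V m - V l"
          using variation_boundD[OF V, of t m] variation_bound_mono[OF V, of l t] t lm by force
        ultimately show ?thesis
          using ht by (simp add: norm_mult mult_mono')
      qed
    qed (use lm in \<open>auto simp: min_def\<close>)
    also have "\<dots> \<le> M * (V m - V l) * \<delta>"
      using lm \<open>M > 0\<close> variation_bound_mono[OF V, of l m] by (intro mult_left_mono) auto
    also have "integral {a..b} (\<lambda>t. ?E1 t - ?E2 t)
       = integral {x..b} (\<lambda>t. h t x) * (g m - g l) - integral {a..b} ?E2"
      using integral_unique[OF has_integral_diff[OF E1 integrable_integral[OF E2]]] .
    finally show ?thesis using lm by (simp add: mult_ac)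
  qed
  show "has_rs_integral (\<lambda>x. integral {x..b} (\<lambda>t. h t x)) g a b (integral {a..b} ?R)"
    unfolding has_rs_integral_iff
  proof (intro allI impI)
    fix e :: real assume "e > 0"
    then have "e/2 > 0" by simp
    have "\<exists>\<delta>>0. \<forall>p. fine_division \<delta> a b p \<longrightarrow>
       norm ((\<Sum>(x, K)\<in>p. integral {a..b} (\<lambda>t. h t x * (g (min t (Sup K)) - g (min t (Inf K))))) -
             integral {a..b} ?R) < e/2"
      unfolding R[symmetric] by (rule approx(2)) (use \<open>e/2 > 0\<close> in auto)
    then obtain \<delta> where "\<delta> > 0" and \<delta>: "\<And>p. fine_division \<delta> a b p \<Longrightarrow>
       norm ((\<Sum>(x, K)\<in>p. integral {a..b} (\<lambda>t. h t x * (g (min t (Sup K)) - g (min t (Inf K))))) -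
             integral {a..b} ?R) < e/2"
      by blast
    \<comment> \<open>the second bound on the mesh makes the total cost of the cells at most \<open>e/2\<close>\<close>
    define \<delta>' where "\<delta>' = min \<delta> (e / (2 * M * W))"
    have "\<delta>' > 0" using \<open>\<delta> > 0\<close> \<open>e > 0\<close> \<open>M > 0\<close> W by (simp add: \<delta>'_def)
    have "norm (rs_sum (\<lambda>x. integral {x..b} (\<lambda>t. h t x)) g p - integral {a..b} ?R) < e"
      if p: "fine_division \<delta>' a b p" for p
    proof -
      let ?S = "rs_sum (\<lambda>x. integral {x..b} (\<lambda>t. h t x)) g p"
      let ?T = "\<Sum>(x, K)\<in>p. integral {a..b} (\<lambda>t. h t x * (g (min t (Sup K)) - g (min t (Inf K))))"
      have "norm (?S - ?T) \<le> (\<Sum>(x, K)\<in>p. M * \<delta>' * (V (Sup K) - V (Inf K)))"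
        unfolding rs_sum_def sum_subtractf[symmetric] case_prod_unfold
        using cell[OF p] by (intro sum_norm_le) auto
      also have "\<dots> = M * \<delta>' * (V b - V a)"
        using sum_increments_fine_division[OF ab p, of V]
        by (simp add: case_prod_unfold flip: sum_distrib_left)
      also have "\<dots> \<le> M * \<delta>' * W"
        using \<open>M > 0\<close> \<open>\<delta>' > 0\<close> by (intro mult_left_mono) (auto simp: W_def)
      also have "\<dots> \<le> M * (e / (2 * M * W)) * W"
        using \<open>M > 0\<close> W by (intro mult_right_mono mult_left_mono) (auto simp: \<delta>'_def)
      also have "\<dots> = e/2"
        using \<open>M > 0\<close> W by simp
      finally have "norm (?S - ?T) \<le> e/2" .
      moreover have "norm (?T - integral {a..b} ?R) < e/2"
        by (rule \<delta>[OF fine_division_mono[OF p]]) (simp add: \<delta>'_def)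
      ultimately show ?thesis
        using norm_triangle_ineq[of "?S - ?T" "?T - integral {a..b} ?R"] by simp
    qed
    then show "\<exists>d>0. \<forall>p. fine_division d a b p \<longrightarrow>
        norm (rs_sum (\<lambda>x. integral {x..b} (\<lambda>t. h t x)) g p - integral {a..b} ?R) < e"
      using \<open>\<delta>' > 0\<close> by blast
  qed
qed

section \<open>The scalar identity\<close>

text \<open>The double integral of the bilinear form for the segments at time \<open>\<tau>\<close>, with the order of integration
exchanged on the triangle \<open>\<theta> \<le> \<xi>\<close> and with \<open>s = \<tau> + \<xi>\<close> as the new variable.\<close>
lemma
  fixes f g \<eta> :: "real \<Rightarrow> complex"
  assumes r: "r > 0" and V: "variation_bound V \<eta> (- r) 0"
    and f: "continuous_on UNIV f" and g: "continuous_on UNIV g"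
  shows integrable_delay_pairing:
      "(\<lambda>\<xi>. rs_integral (\<lambda>\<theta>. f (\<tau> + (\<xi> - \<theta>))) \<eta> (- r) \<xi> * g (\<tau> + \<xi>)) integrable_on {- r..0}"
    and has_rs_integral_delay_pairing:
      "has_rs_integral (\<lambda>\<theta>. integral {\<tau> + \<theta>..\<tau>} (\<lambda>s. f (s - \<theta>) * g s)) \<eta> (- r) 0
         (integral {- r..0} (\<lambda>\<xi>. rs_integral (\<lambda>\<theta>. f (\<tau> + (\<xi> - \<theta>))) \<eta> (- r) \<xi> * g (\<tau> + \<xi>)))"
proof -
  let ?h = "\<lambda>\<xi> \<theta>. f (\<tau> + (\<xi> - \<theta>)) * g (\<tau> + \<xi>)"
  have h: "continuous_on S (\<lambda>(\<xi>, \<theta>). ?h \<xi> \<theta>)" for S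
    unfolding case_prod_unfold
    by (intro continuous_intros continuous_on_compose2[OF f] continuous_on_compose2[OF g]) auto
  have mult: "rs_integral (?h \<xi>) \<eta> (- r) \<xi> = rs_integral (\<lambda>\<theta>. f (\<tau> + (\<xi> - \<theta>))) \<eta> (- r) \<xi> * g (\<tau> + \<xi>)"
    if "\<xi> \<in> {- r..0}" for \<xi>
  proof -
    have "variation_bound V \<eta> (- r) \<xi>"
      using V that by (auto simp: variation_bound_def)
    then show ?thesis
      using that by (intro rs_integral_eqI has_rs_integral_mult_right has_rs_integral_rs_integral
          continuous_intros continuous_on_compose2[OF f]) auto
  qed
  note fubini = integrable_rs_integral_triangle[OF V _ h] has_rs_integral_integral_triangle[OF V _ h]
  show "(\<lambda>\<xi>. rs_integral (\<lambda>\<theta>. f (\<tau> + (\<xi> - \<theta>))) \<eta> (- r) \<xi> * g (\<tau> + \<xi>)) integrable_on {- r..0}"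
    using r by (intro integrable_eq[OF fubini(1)] mult) auto
  have "integral {\<theta>..0} (\<lambda>\<xi>. ?h \<xi> \<theta>) = integral {\<tau> + \<theta>..\<tau>} (\<lambda>s. f (s - \<theta>) * g s)" for \<theta>
    using integral_shift_real_ivl[of "\<tau> + \<theta>" \<tau> \<tau> "\<lambda>s. f (s - \<theta>) * g s"]
    by (simp add: algebra_simps)
  moreover have "integral {- r..0} (\<lambda>\<xi>. rs_integral (?h \<xi>) \<eta> (- r) \<xi>)
      = integral {- r..0} (\<lambda>\<xi>. rs_integral (\<lambda>\<theta>. f (\<tau> + (\<xi> - \<theta>))) \<eta> (- r) \<xi> * g (\<tau> + \<xi>))"
    by (intro integral_cong mult)
  ultimately show "has_rs_integral (\<lambda>\<theta>. integral {\<tau> + \<theta>..\<tau>} (\<lambda>s. f (s - \<theta>) * g s)) \<eta> (- r) 0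
         (integral {- r..0} (\<lambda>\<xi>. rs_integral (\<lambda>\<theta>. f (\<tau> + (\<xi> - \<theta>))) \<eta> (- r) \<xi> * g (\<tau> + \<xi>)))"
    using fubini(2) r by simp
qed

lemma integral_shift_identity:
  fixes H :: "real \<Rightarrow> complex"
  assumes H: "continuous_on UNIV H" and \<theta>: "\<theta> \<le> 0" and \<alpha>\<beta>: "\<alpha> \<le> \<beta>"
  shows "integral {\<alpha>..\<beta>} H - integral {\<alpha> + \<theta>..\<beta> + \<theta>} H
       = integral {\<beta> + \<theta>..\<beta>} H - integral {\<alpha> + \<theta>..\<alpha>} H"
proof -
  have int: "H integrable_on {c..d}" for c d
    by (intro integrable_continuous_real continuous_on_subset[OF H]) auto
  have "integral {\<alpha> + \<theta>..\<alpha>} H + integral {\<alpha>..\<beta>} H = integral {\<alpha> + \<theta>..\<beta>} H"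
    using assms by (intro Henstock_Kurzweil_Integration.integral_combine int) auto
  moreover have "integral {\<alpha> + \<theta>..\<beta> + \<theta>} H + integral {\<beta> + \<theta>..\<beta>} H = integral {\<alpha> + \<theta>..\<beta>} H"
    using assms by (intro Henstock_Kurzweil_Integration.integral_combine int) auto
  ultimately show ?thesis by (simp add: algebra_simps)
qed

text \<open>The part of the claim in which no derivative occurs. Both sides are integrals against \<open>\<eta>\<close>, by the two
exchange theorems, and their integrands agree for every \<open>\<theta>\<close> by the preceding lemma. The
exchange theorems also supply the existence of the integrals whose differences are formed. Continuity on the whole line is assumed to keep the domains out of the way.\<close>
lemma
  fixes f g \<eta> :: "real \<Rightarrow> complex"
  assumes r: "r > 0" and V: "variation_bound V \<eta> (- r) 0" and \<alpha>\<beta>: "\<alpha> \<le> \<beta>"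
    and f: "continuous_on UNIV f" and g: "continuous_on UNIV g"
  shows integrable_advanced_term: "(\<lambda>t. rs_integral (\<lambda>\<theta>. f (t - \<theta>)) \<eta> (- r) 0 * g t) integrable_on {\<alpha>..\<beta>}"
    and integrable_delayed_term: "(\<lambda>t. f t * rs_integral (\<lambda>\<theta>. g (t + \<theta>)) \<eta> (- r) 0) integrable_on {\<alpha>..\<beta>}"
    and delay_pairing_increment:
      "integral {\<alpha>..\<beta>} (\<lambda>t. rs_integral (\<lambda>\<theta>. f (t - \<theta>)) \<eta> (- r) 0 * g t)
       - integral {\<alpha>..\<beta>} (\<lambda>t. f t * rs_integral (\<lambda>\<theta>. g (t + \<theta>)) \<eta> (- r) 0)
       = integral {- r..0} (\<lambda>\<xi>. rs_integral (\<lambda>\<theta>. f (\<beta> + (\<xi> - \<theta>))) \<eta> (- r) \<xi> * g (\<beta> + \<xi>))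
       - integral {- r..0} (\<lambda>\<xi>. rs_integral (\<lambda>\<theta>. f (\<alpha> + (\<xi> - \<theta>))) \<eta> (- r) \<xi> * g (\<alpha> + \<xi>))"
proof -
  let ?R = "\<lambda>t. rs_integral (\<lambda>\<theta>. f (t - \<theta>)) \<eta> (- r) 0 * g t"
  let ?S = "\<lambda>t. f t * rs_integral (\<lambda>\<theta>. g (t + \<theta>)) \<eta> (- r) 0"
  let ?T = "\<lambda>\<tau>. integral {- r..0} (\<lambda>\<xi>. rs_integral (\<lambda>\<theta>. f (\<tau> + (\<xi> - \<theta>))) \<eta> (- r) \<xi> * g (\<tau> + \<xi>))"
  let ?H = "\<lambda>\<theta> s. f (s - \<theta>) * g s"
  have cf: "continuous_on A (\<lambda>x. f (k x))" if "continuous_on A k" for A :: "'b::topological_space set" and k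
    by (rule continuous_on_compose2[OF f that]) auto
  have cg: "continuous_on A (\<lambda>x. g (k x))" if "continuous_on A k" for A :: "'b::topological_space set" and k
    by (rule continuous_on_compose2[OF g that]) auto
  have R: "rs_integral (\<lambda>\<theta>. f (t - \<theta>) * g t) \<eta> (- r) 0 = ?R t" for t
    using r by (intro rs_integral_eqI has_rs_integral_mult_right has_rs_integral_rs_integral[OF V]
        continuous_intros cf) auto
  have S: "rs_integral (\<lambda>\<theta>. g (t + \<theta>) * f t) \<eta> (- r) 0 = ?S t" for t
    using r by (subst mult.commute[of "f t"]) (intro rs_integral_eqI has_rs_integral_mult_right
        has_rs_integral_rs_integral[OF V] continuous_intros cg, auto)
  have hR: "continuous_on A (\<lambda>(t, \<theta>). f (t - \<theta>) * g t)" for A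
    unfolding case_prod_unfold by (intro continuous_intros cf cg)
  have hS: "continuous_on A (\<lambda>(t, \<theta>). g (t + \<theta>) * f t)" for A
    unfolding case_prod_unfold by (intro continuous_intros cf cg)
  show "?R integrable_on {\<alpha>..\<beta>}"
    using integrable_rs_integral[OF V _ \<alpha>\<beta> hR] r by (simp add: R)
  show "?S integrable_on {\<alpha>..\<beta>}"
    using integrable_rs_integral[OF V _ \<alpha>\<beta> hS] r by (simp add: S)
  have "has_rs_integral (\<lambda>\<theta>. integral {\<alpha>..\<beta>} (?H \<theta>)) \<eta> (- r) 0 (integral {\<alpha>..\<beta>} ?R)"
    using has_rs_integral_integral[OF V _ \<alpha>\<beta> hR] r by (simp add: R)
  moreover have "has_rs_integral (\<lambda>\<theta>. integral {\<alpha> + \<theta>..\<beta> + \<theta>} (?H \<theta>)) \<eta> (- r) 0 (integral {\<alpha>..\<beta>} ?S)"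
  proof -
    have "integral {\<alpha>..\<beta>} (\<lambda>t. g (t + \<theta>) * f t) = integral {\<alpha> + \<theta>..\<beta> + \<theta>} (?H \<theta>)" for \<theta>
      using integral_shift_real_ivl[of "\<alpha> + \<theta>" \<theta> "\<beta> + \<theta>" "?H \<theta>"] by (simp add: mult.commute)
    then show ?thesis
      using has_rs_integral_integral[OF V _ \<alpha>\<beta> hS] r by (simp add: S)
  qed
  ultimately have LHS: "has_rs_integral (\<lambda>\<theta>. integral {\<alpha>..\<beta>} (?H \<theta>) - integral {\<alpha> + \<theta>..\<beta> + \<theta>} (?H \<theta>)) \<eta> (- r) 0
      (integral {\<alpha>..\<beta>} ?R - integral {\<alpha>..\<beta>} ?S)"
    by (rule has_rs_integral_diff)
  have RHS: "has_rs_integral (\<lambda>\<theta>. integral {\<beta> + \<theta>..\<beta>} (?H \<theta>) - integral {\<alpha> + \<theta>..\<alpha>} (?H \<theta>)) \<eta> (- r) 0 (?T \<beta> - ?T \<alpha>)"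
    by (intro has_rs_integral_diff has_rs_integral_delay_pairing[OF r V f g])
  have "has_rs_integral (\<lambda>\<theta>. integral {\<alpha>..\<beta>} (?H \<theta>) - integral {\<alpha> + \<theta>..\<beta> + \<theta>} (?H \<theta>)) \<eta> (- r) 0 (?T \<beta> - ?T \<alpha>)"
    using RHS
  proof (rule has_rs_integral_cong[THEN iffD1, rotated])
    fix \<theta> :: real assume "\<theta> \<in> {- r..0}"
    then show "integral {\<beta> + \<theta>..\<beta>} (?H \<theta>) - integral {\<alpha> + \<theta>..\<alpha>} (?H \<theta>)
        = integral {\<alpha>..\<beta>} (?H \<theta>) - integral {\<alpha> + \<theta>..\<beta> + \<theta>} (?H \<theta>)"
      using \<alpha>\<beta> by (intro integral_shift_identity[symmetric] continuous_intros cf cg g) auto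
  qed
  with LHS show "integral {\<alpha>..\<beta>} ?R - integral {\<alpha>..\<beta>} ?S = ?T \<beta> - ?T \<alpha>"
    by (rule has_rs_integral_unique)
qed

section \<open>Assembling the vector identity\<close>

lemma scalar_product_add_left: "scalar_product (x + y) z = scalar_product x z + scalar_product y z"
  by (simp add: scalar_product_def distrib_right sum.distrib)

lemma scalar_product_diff_right:
  "scalar_product (x :: complex ^ 'n) (y - z) = scalar_product x y - scalar_product x z"
  by (simp add: scalar_product_def right_diff_distrib sum_subtractf)

lemma scalar_product_rs_integral_row:
  "scalar_product (rs_integral_row \<psi> \<eta> a b) x =
     (\<Sum>i\<in>UNIV. \<Sum>j\<in>UNIV. rs_integral (\<lambda>\<theta>. \<psi> \<theta> $ i) (\<lambda>\<theta>. \<eta> \<theta> $ i $ j) a b * x $ j)"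
  unfolding scalar_product_def rs_integral_row_def
  by (subst sum.swap) (simp add: sum_distrib_right)

lemma scalar_product_rs_integral_col:
  "scalar_product x (rs_integral_col \<eta> \<phi> a b) =
     (\<Sum>i\<in>UNIV. \<Sum>j\<in>UNIV. x $ i * rs_integral (\<lambda>\<theta>. \<phi> \<theta> $ j) (\<lambda>\<theta>. \<eta> \<theta> $ i $ j) a b)"
  by (simp add: scalar_product_def rs_integral_col_def sum_distrib_left)

lemma has_integral_scalar_product_derivative:
  fixes u v :: "real \<Rightarrow> complex ^ 'n"
  assumes "\<alpha> \<le> \<beta>"
    and u: "\<And>t. t \<in> {\<alpha>..\<beta>} \<Longrightarrow> (u has_vector_derivative u' t) (at t within {\<alpha>..\<beta>})"
    and v: "\<And>t. t \<in> {\<alpha>..\<beta>} \<Longrightarrow> (v has_vector_derivative v' t) (at t within {\<alpha>..\<beta>})"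
  shows "((\<lambda>t. scalar_product (v' t) (u t) + scalar_product (v t) (u' t)) has_integral
            (scalar_product (v \<beta>) (u \<beta>) - scalar_product (v \<alpha>) (u \<alpha>))) {\<alpha>..\<beta>}"
proof (rule fundamental_theorem_of_calculus[OF assms(1)])
  fix t assume t: "t \<in> {\<alpha>..\<beta>}"
  have "((\<lambda>t. scalar_product (v t) (u t)) has_vector_derivative
      (\<Sum>i\<in>UNIV. v t $ i * u' t $ i + v' t $ i * u t $ i)) (at t within {\<alpha>..\<beta>})"
    unfolding scalar_product_def
    by (intro has_vector_derivative_sum has_vector_derivative_mult
        bounded_linear.has_vector_derivative[OF bounded_linear_vec_nth] u[OF t] v[OF t])
  then show "((\<lambda>t. scalar_product (v t) (u t)) has_vector_derivative
      scalar_product (v' t) (u t) + scalar_product (v t) (u' t)) (at t within {\<alpha>..\<beta>})"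
    by (simp add: scalar_product_def sum.distrib add.commute)
qed

text \<open>The claim for arbitrary derivatives \<open>u'\<close> and \<open>v'\<close>, together with the integrability of the integrand.
The scalar identity is applied to the entries of continuous extensions \<open>ux\<close> and \<open>vx\<close> of \<open>u\<close> and \<open>v\<close> to
the whole line; all integrals involve only arguments at which the extensions agree with the given
functions.\<close>
lemma bilinear_form_increment:
  fixes r \<alpha> \<beta> :: real
    and \<eta> :: "real \<Rightarrow> complex ^ 'n ^ 'n"
    and u v u' v' :: "real \<Rightarrow> complex ^ 'n"
  assumes r: "r > 0"
    and V: "variation_bound V \<eta> (- r) 0"
    and \<alpha>\<beta>: "\<alpha> \<le> \<beta>"
    and u: "continuous_on {\<alpha> - r..\<beta>} u"
    and v: "continuous_on {\<alpha>..\<beta> + r} v"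
    and u': "\<And>t. t \<in> {\<alpha>..\<beta>} \<Longrightarrow> (u has_vector_derivative u' t) (at t within {\<alpha>..\<beta>})"
    and v': "\<And>t. t \<in> {\<alpha>..\<beta>} \<Longrightarrow> (v has_vector_derivative v' t) (at t within {\<alpha>..\<beta>})"
  shows "((\<lambda>t. scalar_product (v' t + rs_integral_row (\<lambda>\<theta>. v (t - \<theta>)) \<eta> (- r) 0) (u t) +
               scalar_product (v t) (u' t - rs_integral_col \<eta> (\<lambda>\<theta>. u (t + \<theta>)) (- r) 0))
         has_integral
           (bilinear_B r \<eta> (segment_at v \<beta>) (segment_at u \<beta>)
            - bilinear_B r \<eta> (segment_at v \<alpha>) (segment_at u \<alpha>))) {\<alpha>..\<beta>}"
proof -
  define vx where "vx = ext_cont v \<alpha> (\<beta> + r)"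
  define ux where "ux = ext_cont u (\<alpha> - r) \<beta>"
  have vx: "vx t = v t" if "\<alpha> \<le> t" "t \<le> \<beta> + r" for t
    using that by (simp add: vx_def)
  have ux: "ux t = u t" if "\<alpha> - r \<le> t" "t \<le> \<beta>" for t
    using that by (simp add: ux_def)
  have cont_vx: "continuous_on UNIV (\<lambda>t. vx t $ i)" for i
    using v unfolding vx_def by (intro continuous_intros) auto
  have cont_ux: "continuous_on UNIV (\<lambda>t. ux t $ i)" for i
    using u unfolding ux_def by (intro continuous_intros) auto
  let ?\<eta> = "\<lambda>i j \<theta>. \<eta> \<theta> $ i $ j"
  let ?R = "\<lambda>i j t. rs_integral (\<lambda>\<theta>. vx (t - \<theta>) $ i) (?\<eta> i j) (- r) 0 * ux t $ j"
  let ?S = "\<lambda>i j t. vx t $ i * rs_integral (\<lambda>\<theta>. ux (t + \<theta>) $ j) (?\<eta> i j) (- r) 0"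
  let ?q = "\<lambda>i j \<tau> \<xi>. rs_integral (\<lambda>\<theta>. vx (\<tau> + (\<xi> - \<theta>)) $ i) (?\<eta> i j) (- r) \<xi> * ux (\<tau> + \<xi>) $ j"
  note V' = variation_bound_component[OF V]
  have B: "bilinear_B r \<eta> (segment_at v \<tau>) (segment_at u \<tau>)
      = scalar_product (v \<tau>) (u \<tau>) + (\<Sum>i\<in>UNIV. \<Sum>j\<in>UNIV. integral {- r..0} (?q i j \<tau>))"
    if \<tau>: "\<tau> \<in> {\<alpha>..\<beta>}" for \<tau>
  proof -
    have "integral {- r..0} (\<lambda>\<xi>. scalar_product
            (rs_integral_row (\<lambda>\<theta>. segment_at v \<tau> (\<xi> - \<theta>)) \<eta> (- r) \<xi>) (segment_at u \<tau> \<xi>))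
        = integral {- r..0} (\<lambda>\<xi>. \<Sum>i\<in>UNIV. \<Sum>j\<in>UNIV. ?q i j \<tau> \<xi>)"
      unfolding scalar_product_rs_integral_row segment_at_def
      using \<tau> by (intro integral_cong sum.cong refl arg_cong2[where f = "(*)"] rs_integral_cong) (auto simp: ux vx)
    also have "\<dots> = (\<Sum>i\<in>UNIV. \<Sum>j\<in>UNIV. integral {- r..0} (?q i j \<tau>))"
      by (simp add: integral_sum integrable_sum integrable_delay_pairing[OF r V' cont_vx cont_ux])
    finally show ?thesis by (simp add: bilinear_B_def segment_at_def)
  qed
  have "((\<lambda>t. ?R i j t - ?S i j t) has_integral (integral {- r..0} (?q i j \<beta>) - integral {- r..0} (?q i j \<alpha>))) {\<alpha>..\<beta>}"
    for i j
    unfolding delay_pairing_increment[OF r V' \<alpha>\<beta> cont_vx cont_ux, symmetric]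
    by (intro has_integral_diff integrable_integral
        integrable_advanced_term[OF r V' \<alpha>\<beta> cont_vx cont_ux]
        integrable_delayed_term[OF r V' \<alpha>\<beta> cont_vx cont_ux])
  then have total: "((\<lambda>t. (scalar_product (v' t) (u t) + scalar_product (v t) (u' t)) + (\<Sum>i\<in>UNIV. \<Sum>j\<in>UNIV. ?R i j t - ?S i j t))
      has_integral ((scalar_product (v \<beta>) (u \<beta>) - scalar_product (v \<alpha>) (u \<alpha>))
       + (\<Sum>i\<in>UNIV. \<Sum>j\<in>UNIV. integral {- r..0} (?q i j \<beta>) - integral {- r..0} (?q i j \<alpha>)))) {\<alpha>..\<beta>}"
    by (intro has_integral_add has_integral_sum has_integral_scalar_product_derivative \<alpha>\<beta> u' v') auto
  have value_eq: "(scalar_product (v \<beta>) (u \<beta>) - scalar_product (v \<alpha>) (u \<alpha>))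
       + (\<Sum>i\<in>UNIV. \<Sum>j\<in>UNIV. integral {- r..0} (?q i j \<beta>) - integral {- r..0} (?q i j \<alpha>))
      = bilinear_B r \<eta> (segment_at v \<beta>) (segment_at u \<beta>) - bilinear_B r \<eta> (segment_at v \<alpha>) (segment_at u \<alpha>)"
    using \<alpha>\<beta> by (simp add: B sum_subtractf)
  have integrand_eq: "(scalar_product (v' t) (u t) + scalar_product (v t) (u' t)) + (\<Sum>i\<in>UNIV. \<Sum>j\<in>UNIV. ?R i j t - ?S i j t)
      = scalar_product (v' t + rs_integral_row (\<lambda>\<theta>. v (t - \<theta>)) \<eta> (- r) 0) (u t) +
        scalar_product (v t) (u' t - rs_integral_col \<eta> (\<lambda>\<theta>. u (t + \<theta>)) (- r) 0)"
    if t: "t \<in> {\<alpha>..\<beta>}" for t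
  proof -
    have "scalar_product (rs_integral_row (\<lambda>\<theta>. v (t - \<theta>)) \<eta> (- r) 0) (u t) = (\<Sum>i\<in>UNIV. \<Sum>j\<in>UNIV. ?R i j t)"
      unfolding scalar_product_rs_integral_row
      using t r by (intro sum.cong refl arg_cong2[where f = "(*)"] rs_integral_cong) (auto simp: ux vx)
    moreover have "scalar_product (v t) (rs_integral_col \<eta> (\<lambda>\<theta>. u (t + \<theta>)) (- r) 0) = (\<Sum>i\<in>UNIV. \<Sum>j\<in>UNIV. ?S i j t)"
      unfolding scalar_product_rs_integral_col
      using t r by (intro sum.cong refl arg_cong2[where f = "(*)"] rs_integral_cong) (auto simp: ux vx)
    ultimately show ?thesis
      by (simp add: scalar_product_add_left scalar_product_diff_right sum_subtractf)
  qed
  from has_integral_eq[OF integrand_eq total[unfolded value_eq]] show ?thesis .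
qed

theorem theorem2p7:
  fixes r \<alpha> \<beta> :: real
    and \<eta> :: "real \<Rightarrow> complex ^ 'n ^ 'n"
    and u v :: "real \<Rightarrow> complex ^ 'n"
  assumes "r > 0"
    and "bounded_variation_on \<eta> (- r) 0"
    and "\<alpha> \<le> \<beta>"
    and "continuous_on {\<alpha> - r..\<beta>} u"
    and "continuous_on {\<alpha>..\<beta> + r} v"
    and "continuously_differentiable_within u {\<alpha>..\<beta>}"
    and "continuously_differentiable_within v {\<alpha>..\<beta>}"
  shows "integral {\<alpha>..\<beta>} (\<lambda>t.
           scalar_product
             (vector_derivative v (at t within {\<alpha>..\<beta>}) + rs_integral_row (\<lambda>\<theta>. v (t - \<theta>)) \<eta> (- r) 0)
             (u t) +
           scalar_product (v t)
             (vector_derivative u (at t within {\<alpha>..\<beta>}) - rs_integral_col \<eta> (\<lambda>\<theta>. u (t + \<theta>)) (- r) 0))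
         = bilinear_B r \<eta> (segment_at v \<beta>) (segment_at u \<beta>)
           - bilinear_B r \<eta> (segment_at v \<alpha>) (segment_at u \<alpha>)"
proof -
  \<comment> \<open>this also covers \<open>\<alpha> = \<beta>\<close>, where every vector is a derivative and \<open>vector_derivative\<close> selects one\<close>
  have deriv: "(w has_vector_derivative vector_derivative w (at t within {\<alpha>..\<beta>})) (at t within {\<alpha>..\<beta>})"
    if "continuously_differentiable_within w {\<alpha>..\<beta>}" "t \<in> {\<alpha>..\<beta>}" for w :: "real \<Rightarrow> complex ^ 'n" and t
    using that unfolding continuously_differentiable_within_def
    by (metis differentiableI_vector vector_derivative_works)
  obtain V where V: "variation_bound V \<eta> (- r) 0"
    using bounded_variation_imp_variation_bound[OF assms(2)] .
  show ?thesis
    by (intro integral_unique bilinear_form_increment[OF assms(1) V assms(3-5)] deriv assms(6,7))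
qed

end
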